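(* Let $1\le k\le n$. The cycle-type partition of $V(n,k)$ is an equitable partition of the arrangement graph $A(n,k)$.
   Context: $[\ell]=\{1,\dots,\ell\}$. A $k$-permutation of $[n]$ is an injective map $\pi:[k]\to[n]$, written $(\pi(1),\dots,\pi(k))$; $V(n,k)$ is the set of all of them. The arrangement graph $A(n,k)$ has vertex set $V(n,k)$, with $\pi,\rho$ adjacent iff there is exactly one $i\in[k]$ with $\pi(i)\neq\rho(i)$. Every $k$-permutation decomposes uniquely into disjoint cycles (distinct $u_1,\dots,u_\ell\in[k]$, up to rotation, with $\pi(u_t)=u_{t+1}$ for $t<\ell$, $\pi(u_\ell)=u_1$) and paths (distinct $u_1,\dots,u_\ell\in[k]$ with $\pi(u_t)=u_{t+1}$ for $t<\ell$ and $\pi(u_\ell)\notin[k]$), whose elements in $[k]$ partition $[k]$. The cycle type of $\pi$ records, for each $\ell$, the number of cycles of length $\ell$ and the number of paths of length $\ell$ in this decomposition. The cycle-type partition of $V(n,k)$ is the partition into classes of $k$-permutations having the same cycle type. A partition $(V_1,\dots,V_m)$ of the vertex set of a graph is equitable if for all $i,j$ (possibly $i=j$) every vertex in $V_i$ has the same number of neighbours in $V_j$. *)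

theory Defs
  imports "Graph_Theory.Pair_Digraph" "HOL-Library.FuncSet" "HOL-Library.Disjoint_Sets"
begin

section \<open>The arrangement graph\<close>

text \<open>
  Maps with domain \<open>{1..k}\<close> are extensional functions, so that equality of functions is
  equality of $k$-permutations.
\<close>

definition k_perms :: "nat \<Rightarrow> nat \<Rightarrow> (nat \<Rightarrow> nat) set" where
  "k_perms n k = {\<pi> \<in> {1..k} \<rightarrow>\<^sub>E {1..n}. inj_on \<pi> {1..k}}"

text \<open>
  An undirected graph is a pair digraph with a symmetric arc relation; see
  \<open>pair_graph_arrangement_graph\<close> below.
\<close>

definition arrangement_graph :: "nat \<Rightarrow> nat \<Rightarrow> (nat \<Rightarrow> nat) pair_pre_digraph" where
  "arrangement_graph n k =
     \<lparr> pverts = k_perms n k,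
       parcs = {(\<pi>, \<rho>). \<pi> \<in> k_perms n k \<and> \<rho> \<in> k_perms n k \<and>
                        (\<exists>!i. i \<in> {1..k} \<and> \<pi> i \<noteq> \<rho> i)} \<rparr>"

text \<open>Meant for graphs with finitely many vertices, where \<open>card\<close> counts the neighbours.\<close>

definition equitable_partition :: "'a pair_pre_digraph \<Rightarrow> 'a set set \<Rightarrow> bool" where
  "equitable_partition G P \<longleftrightarrow>
     partition_on (pverts G) P \<and>
     (\<forall>A\<in>P. \<forall>B\<in>P. \<exists>d. \<forall>v\<in>A. card {w \<in> B. (v, w) \<in> parcs G} = d)"


section \<open>Cycles and paths of a k-permutation\<close>

definition is_chain :: "nat \<Rightarrow> (nat \<Rightarrow> nat) \<Rightarrow> nat list \<Rightarrow> bool" where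
  "is_chain k \<pi> us \<longleftrightarrow> us \<noteq> [] \<and> distinct us \<and> set us \<subseteq> {1..k} \<and>
     (\<forall>t. Suc t < length us \<longrightarrow> \<pi> (us ! t) = us ! Suc t)"

definition is_cycle :: "nat \<Rightarrow> (nat \<Rightarrow> nat) \<Rightarrow> nat list \<Rightarrow> bool" where
  "is_cycle k \<pi> us \<longleftrightarrow> is_chain k \<pi> us \<and> \<pi> (last us) = hd us"

definition is_path :: "nat \<Rightarrow> (nat \<Rightarrow> nat) \<Rightarrow> nat list \<Rightarrow> bool" where
  "is_path k \<pi> us \<longleftrightarrow> is_chain k \<pi> us \<and> \<pi> (last us) \<notin> {1..k}"

definition rotations :: "'a list \<Rightarrow> 'a list set" where
  "rotations us = range (\<lambda>m. rotate m us)"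

text \<open>A cycle is identified with the set of all rotations of the lists representing it.\<close>

datatype component = Cycle "nat list set" | Path "nat list"

fun elements :: "component \<Rightarrow> nat set" where
  "elements (Cycle R) = (\<Union>us\<in>R. set us)"
| "elements (Path us) = set us"

definition components :: "nat \<Rightarrow> (nat \<Rightarrow> nat) \<Rightarrow> component set" where
  "components k \<pi> =
     {Cycle (rotations us) | us. is_cycle k \<pi> us} \<union> {Path us | us. is_path k \<pi> us}"

text \<open>
  Every nonempty final segment of a path satisfies \<^const>\<open>is_path\<close> as well; that the paths of a
  decomposition are maximal is a consequence of the components partitioning \<open>{1..k}\<close>.
\<close>

definition is_decomposition :: "nat \<Rightarrow> (nat \<Rightarrow> nat) \<Rightarrow> component set \<Rightarrow> bool" where
  "is_decomposition k \<pi> D \<longleftrightarrow>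
     D \<subseteq> components k \<pi> \<and> disjoint_family_on elements D \<and> (\<Union>x\<in>D. elements x) = {1..k}"

text \<open>Well-defined on \<^const>\<open>k_perms\<close> by \<open>ex1_decomposition\<close> below.\<close>

definition decomposition :: "nat \<Rightarrow> (nat \<Rightarrow> nat) \<Rightarrow> component set" where
  "decomposition k \<pi> = (THE D. is_decomposition k \<pi> D)"

definition num_cycles :: "nat \<Rightarrow> (nat \<Rightarrow> nat) \<Rightarrow> nat \<Rightarrow> nat" where
  "num_cycles k \<pi> l =
     card {x \<in> decomposition k \<pi>. \<exists>us. x = Cycle (rotations us) \<and> length us = l}"

definition num_paths :: "nat \<Rightarrow> (nat \<Rightarrow> nat) \<Rightarrow> nat \<Rightarrow> nat" where
  "num_paths k \<pi> l = card {x \<in> decomposition k \<pi>. \<exists>us. x = Path us \<and> length us = l}"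

definition cycle_type :: "nat \<Rightarrow> (nat \<Rightarrow> nat) \<Rightarrow> (nat \<Rightarrow> nat) \<times> (nat \<Rightarrow> nat)" where
  "cycle_type k \<pi> = (num_cycles k \<pi>, num_paths k \<pi>)"

definition cycle_type_partition :: "nat \<Rightarrow> nat \<Rightarrow> (nat \<Rightarrow> nat) set set" where
  "cycle_type_partition n k =
     k_perms n k // {(\<pi>, \<rho>). \<pi> \<in> k_perms n k \<and> \<rho> \<in> k_perms n k \<and>
                            cycle_type k \<pi> = cycle_type k \<rho>}"


section \<open>The arrangement graph is a finite simple graph\<close>

lemma finite_k_perms: "finite (k_perms n k)"
proof -
  have "finite ({1..k} \<rightarrow>\<^sub>E {1..n})"
    by (intro finite_PiE) auto
  then show ?thesis
    unfolding k_perms_def by (rule rev_finite_subset) auto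
qed

lemma pair_graph_arrangement_graph: "pair_graph (arrangement_graph n k)"
proof
  have sub: "parcs (arrangement_graph n k) \<subseteq> k_perms n k \<times> k_perms n k"
    by (auto simp: arrangement_graph_def)
  have verts: "pverts (arrangement_graph n k) = k_perms n k"
    by (simp add: arrangement_graph_def)
  show "finite (pverts (arrangement_graph n k))"
    by (simp add: verts finite_k_perms)
  show "finite (parcs (arrangement_graph n k))"
    using sub by (rule finite_subset) (simp add: finite_k_perms)
  show "fst e \<in> pverts (arrangement_graph n k)" "snd e \<in> pverts (arrangement_graph n k)"
    if "e \<in> parcs (arrangement_graph n k)" for e
    using subsetD[OF sub that] by (simp_all add: verts mem_Times_iff)
  show "fst e \<noteq> snd e" if "e \<in> parcs (arrangement_graph n k)" for e
    using that unfolding arrangement_graph_def by (cases e) auto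
  have "sym (parcs (arrangement_graph n k))"
  proof (rule symI)
    fix \<pi> \<rho> assume "(\<pi>, \<rho>) \<in> parcs (arrangement_graph n k)"
    moreover have "(\<lambda>i. i \<in> {1..k} \<and> \<pi> i \<noteq> \<rho> i) = (\<lambda>i. i \<in> {1..k} \<and> \<rho> i \<noteq> \<pi> i)"
      by metis
    ultimately show "(\<rho>, \<pi>) \<in> parcs (arrangement_graph n k)"
      by (simp add: arrangement_graph_def)
  qed
  then show "symmetric (with_proj (arrangement_graph n k))"
    by (simp add: symmetric_def)
qed


section \<open>Existence and uniqueness of the decomposition\<close>

lemma rotations_self: "us \<in> rotations us"
  unfolding rotations_def by (rule range_eqI[of _ _ 0]) simp

lemma rotations_rotate: "rotations (rotate m us) = rotations us"
proof -
  have "rotate j us \<in> range (\<lambda>i. rotate i (rotate m us))" for j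
  proof (cases "us = []")
    case False
    define i where "i = j + (length us - m mod length us)"
    have "rotate i (rotate m us) = rotate ((i + m) mod length us) us"
      by (simp add: rotate_rotate flip: rotate_conv_mod)
    also have "(i + m) mod length us = (i + m mod length us) mod length us"
      by (simp add: mod_add_right_eq)
    also have "i + m mod length us = j + length us"
      using le_add_diff_inverse2[OF less_imp_le[OF mod_less_divisor[of "length us" m]]] False
      unfolding i_def by (simp only: add.assoc length_greater_0_conv simp_thms)
    also have "rotate ((j + length us) mod length us) us = rotate j us"
      by (simp flip: rotate_conv_mod)
    finally show ?thesis by (metis rangeI)
  next
    case True
    then show ?thesis by simp
  qed
  then show ?thesis
    by (auto simp: rotations_def rotate_rotate)
qed

lemma elements_Cycle_rotations [simp]: "elements (Cycle (rotations us)) = set us"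
  by (auto simp: rotations_def)

declare elements.simps(1) [simp del]

lemma is_cycle_rotate1:
  assumes "is_cycle k \<pi> us"
  shows "is_cycle k \<pi> (rotate1 us)"
proof -
  obtain a vs where us: "us = a # vs"
    using assms by (cases us) (auto simp: is_cycle_def is_chain_def)
  have *: "is_chain k \<pi> us" "\<pi> (last us) = a"
    using assms us by (auto simp: is_cycle_def)
  have step: "\<pi> ((vs @ [a]) ! t) = (vs @ [a]) ! Suc t" if t: "t < length vs" for t
  proof (cases "Suc t < length vs")
    case True
    have "\<pi> (us ! Suc t) = us ! Suc (Suc t)"
      using *(1) True us unfolding is_chain_def by (metis Suc_less_eq length_Cons)
    then show ?thesis using True us by (simp add: nth_append)
  next
    case False
    then have "length vs = Suc t" using t by simp
    then have "last us = vs ! t" using us by (cases vs rule: rev_cases) (auto simp: nth_append)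
    then show ?thesis using *(2) t \<open>length vs = Suc t\<close> by (simp add: nth_append)
  qed
  have "\<pi> a = hd (vs @ [a])"
  proof (cases vs)
    case Nil
    then show ?thesis using *(2) us by simp
  next
    case (Cons b ws)
    have "\<pi> (us ! 0) = us ! Suc 0"
      using *(1) us Cons unfolding is_chain_def by fastforce
    then show ?thesis using us Cons by simp
  qed
  then show ?thesis
    using *(1) us step by (auto simp: is_cycle_def is_chain_def)
qed

lemma is_cycle_rotate: "is_cycle k \<pi> us \<Longrightarrow> is_cycle k \<pi> (rotate m us)"
  by (induction m) (auto simp: is_cycle_rotate1)

lemma is_chain_funpow:
  assumes "is_chain k \<pi> us" "t < length us"
  shows "us ! t = (\<pi> ^^ t) (hd us)"
  using assms(2)
proof (induction t)
  case 0
  then show ?case by (simp add: hd_conv_nth)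
next
  case (Suc t)
  then show ?case using assms(1) by (auto simp: is_chain_def)
qed

lemma is_chain_prefix:
  assumes "is_chain k \<pi> us" "is_chain k \<pi> vs" "hd us = hd vs" "length us \<le> length vs"
  shows "us = take (length us) vs"
proof (rule nth_equalityI)
  fix t assume "t < length us"
  then show "us ! t = take (length us) vs ! t"
    using is_chain_funpow[OF assms(1), of t] is_chain_funpow[OF assms(2), of t] assms(3,4) by simp
next
  show "length us = length (take (length us) vs)" using assms(4) by simp
qed

lemma is_cycle_length_le:
  assumes "is_cycle k \<pi> us" "is_chain k \<pi> vs" "hd us = hd vs"
  shows "length vs \<le> length us"
proof (rule ccontr)
  assume less: "\<not> length vs \<le> length us"
  define l where "l = length us"
  have ne: "us \<noteq> []" "distinct vs" "l > 0" "l < length vs"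
    using assms less by (auto simp: is_cycle_def is_chain_def l_def)
  have "last us = vs ! (l - 1)"
    using is_chain_prefix[of k \<pi> us vs] assms ne less
    by (metis One_nat_def diff_less is_cycle_def l_def last_conv_nth lessI linorder_le_cases
        nth_take zero_less_one)
  then have "vs ! l = hd us"
    using assms ne unfolding is_cycle_def is_chain_def
    by (metis Suc_pred')
  also have "\<dots> = vs ! 0" using assms ne by (metis gr_implies_not0 hd_conv_nth list.size(3))
  finally show False using ne nth_eq_iff_index_eq[of vs l 0] by (metis gr_implies_not0 neq0_conv)
qed

lemma is_path_length_le:
  assumes "is_path k \<pi> us" "is_chain k \<pi> vs" "hd us = hd vs"
  shows "length vs \<le> length us"
proof (rule ccontr)
  assume less: "\<not> length vs \<le> length us"
  define l where "l = length us"
  have ne: "us \<noteq> []" "l > 0" "l < length vs"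
    using assms less by (auto simp: is_path_def is_chain_def l_def)
  have "last us = vs ! (l - 1)"
    using is_chain_prefix[of k \<pi> us vs] assms ne less
    by (metis One_nat_def diff_less is_path_def l_def last_conv_nth lessI linorder_le_cases
        nth_take zero_less_one)
  then have "vs ! l = \<pi> (last us)"
    using assms ne unfolding is_chain_def by (metis Suc_pred')
  moreover have "vs ! l \<in> {1..k}" using assms ne unfolding is_chain_def by (meson nth_mem subsetD)
  ultimately show False using assms by (simp add: is_path_def)
qed

lemma closed_component:
  assumes "x \<in> components k \<pi>" "a \<in> elements x" "\<pi> a \<in> {1..k}"
  shows "\<pi> a \<in> elements x"
proof -
  obtain us where us: "elements x = set us" "is_cycle k \<pi> us \<or> is_path k \<pi> us"
    using assms(1) unfolding components_def
    by auto
  then have ch: "is_chain k \<pi> us" by (auto simp: is_cycle_def is_path_def)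
  obtain t where t: "t < length us" "us ! t = a"
    using assms(2) us(1) by (auto simp: in_set_conv_nth)
  show ?thesis
  proof (cases "Suc t < length us")
    case True
    then have "\<pi> a = us ! Suc t" using ch t by (auto simp: is_chain_def)
    then show ?thesis using True us(1) by simp
  next
    case False
    then have "length us = Suc t" using t by simp
    then have "a = last us" using t by (metis diff_Suc_1 last_conv_nth length_0_conv nat.distinct(1))
    then show ?thesis
      using us assms(3) ch by (auto simp: is_cycle_def is_path_def is_chain_def)
  qed
qed

definition canonical :: "nat \<Rightarrow> (nat \<Rightarrow> nat) \<Rightarrow> component set" where
  "canonical k \<pi> = {Cycle (rotations us) | us. is_cycle k \<pi> us} \<union>
     {Path us | us. is_path k \<pi> us \<and> hd us \<notin> \<pi> ` {1..k}}"

lemma canonical_subset: "canonical k \<pi> \<subseteq> components k \<pi>"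
  by (auto simp: canonical_def components_def)

lemma hd_not_inner:
  assumes "is_chain k \<pi> us" "Suc t < length us"
  shows "\<pi> (us ! t) \<noteq> hd us"
proof -
  have "us \<noteq> []" "distinct us" "\<pi> (us ! t) = us ! Suc t"
    using assms by (simp_all add: is_chain_def)
  moreover have "us ! Suc t \<noteq> us ! 0"
    using nth_eq_iff_index_eq[of us "Suc t" 0] assms(2) \<open>distinct us\<close>
    by (metis Suc_neq_Zero less_trans zero_less_Suc)
  ultimately show ?thesis by (simp add: hd_conv_nth)
qed

lemma chains_meet:
  assumes "inj_on \<pi> {1..k}" "is_chain k \<pi> us" "is_chain k \<pi> vs"
  assumes "i < length us" "j < length vs" "us ! i = vs ! j" "i \<le> j"
  shows "hd us = vs ! (j - i)"
  using assms(4-7)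
proof (induction i arbitrary: j)
  case 0
  then show ?case by (simp add: hd_conv_nth)
next
  case (Suc i)
  then obtain j' where j: "j = Suc j'" by (cases j) auto
  have "\<pi> (us ! i) = \<pi> (vs ! j')"
    using Suc.prems assms(2,3) j by (auto simp: is_chain_def)
  moreover have "us ! i \<in> {1..k}" "vs ! j' \<in> {1..k}"
    using Suc.prems assms(2,3) j unfolding is_chain_def by (meson Suc_lessD nth_mem subsetD)+
  ultimately have "us ! i = vs ! j'" using assms(1) by (auto dest: inj_onD)
  then show ?case using Suc.IH[of j'] Suc.prems j by simp
qed

lemma canonical_paths_meet:
  assumes inj: "inj_on \<pi> {1..k}"
    and us: "is_path k \<pi> us" "hd us \<notin> \<pi> ` {1..k}"
    and vs: "is_path k \<pi> vs" "hd vs \<notin> \<pi> ` {1..k}"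
    and ij: "i < length us" "j < length vs" "us ! i = vs ! j" "i \<le> j"
  shows "us = vs"
proof -
  have ch: "is_chain k \<pi> us" "is_chain k \<pi> vs" using us vs by (auto simp: is_path_def)
  have hd: "hd us = vs ! (j - i)" using chains_meet[OF inj ch ij] .
  have "j = i"
  proof (rule ccontr)
    assume "j \<noteq> i"
    then obtain m where m: "j - i = Suc m" using ij by (metis Suc_diff_Suc le_neq_implies_less)
    then have "Suc m < length vs" using ij by simp
    then have "hd us = \<pi> (vs ! m)" "vs ! m \<in> {1..k}"
      using ch hd m unfolding is_chain_def by (metis, meson Suc_lessD nth_mem subsetD)
    then show False using us by blast
  qed
  then have hd: "hd us = hd vs" using hd ij by (cases vs) auto
  have "length us = length vs"
    using is_path_length_le[OF us(1) ch(2) hd] is_path_length_le[OF vs(1) ch(1) hd[symmetric]]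
    by simp
  then show ?thesis using is_chain_prefix[OF ch hd] by simp
qed

lemma cycle_rotate_to:
  assumes "is_cycle k \<pi> us" "a \<in> set us"
  obtains vs where "is_cycle k \<pi> vs" "rotations vs = rotations us" "set vs = set us" "hd vs = a"
proof -
  obtain t where t: "t < length us" "us ! t = a" using assms(2) by (auto simp: in_set_conv_nth)
  have "us \<noteq> []" using t by auto
  then have "hd (rotate t us) = a" using t by (simp add: hd_rotate_conv_nth)
  then show ?thesis
    using that[of "rotate t us"] is_cycle_rotate[OF assms(1)] by (simp add: rotations_rotate)
qed

lemma cycle_closed:
  assumes "is_cycle k \<pi> us" "a \<in> set us"
  shows "\<pi> a \<in> set us"
proof -
  obtain vs where vs: "is_cycle k \<pi> vs" "set vs = set us" "hd vs = a"
    using cycle_rotate_to[OF assms] by metis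
  then have ch: "is_chain k \<pi> vs" by (simp add: is_cycle_def)
  have "rotate1 vs \<noteq> []" "hd vs = last (rotate1 vs)"
    using ch by (auto simp: is_chain_def, cases vs, auto)
  moreover have "is_cycle k \<pi> (rotate1 vs)" using vs(1) by (rule is_cycle_rotate1)
  ultimately have "\<pi> a = hd (rotate1 vs)" using vs(3) by (simp add: is_cycle_def)
  then have "\<pi> a \<in> set (rotate1 vs)" using \<open>rotate1 vs \<noteq> []\<close> hd_in_set by metis
  then show ?thesis using vs(2) by simp
qed

lemma cycle_path_disjoint:
  assumes "is_cycle k \<pi> us" "is_path k \<pi> vs"
  shows "set us \<inter> set vs = {}"
proof (rule ccontr)
  assume "set us \<inter> set vs \<noteq> {}"
  then obtain a where "a \<in> set us" "a \<in> set vs" by blast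
  then obtain t where t: "t < length vs" "vs ! t \<in> set us" by (metis in_set_conv_nth)
  have ch: "is_chain k \<pi> vs" using assms(2) by (simp add: is_path_def)
  have "vs ! (t + d) \<in> set us" if "t + d < length vs" for d
    using that
  proof (induction d)
    case (Suc d)
    then have "\<pi> (vs ! (t + d)) \<in> set us" by (intro cycle_closed[OF assms(1)]) simp
    then show ?case using Suc.prems ch by (simp add: is_chain_def)
  next
    case 0
    then show ?case using t by simp
  qed
  from this[of "length vs - 1 - t"] have "vs ! (length vs - 1) \<in> set us"
    using t by simp
  then have "last vs \<in> set us"
    using ch by (simp add: last_conv_nth is_chain_def)
  then have "\<pi> (last vs) \<in> {1..k}"
    using cycle_closed[OF assms(1)] assms(1) unfolding is_cycle_def is_chain_def by blast
  then show False using assms(2) by (simp add: is_path_def)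
qed

lemma cycles_meet:
  assumes "is_cycle k \<pi> us" "is_cycle k \<pi> vs" "a \<in> set us" "a \<in> set vs"
  shows "rotations us = rotations vs"
proof -
  obtain us' where us': "is_cycle k \<pi> us'" "rotations us' = rotations us" "hd us' = a"
    using cycle_rotate_to[OF assms(1,3)] by metis
  obtain vs' where vs': "is_cycle k \<pi> vs'" "rotations vs' = rotations vs" "hd vs' = a"
    using cycle_rotate_to[OF assms(2,4)] by metis
  have ch: "is_chain k \<pi> us'" "is_chain k \<pi> vs'" using us' vs' by (auto simp: is_cycle_def)
  have hd: "hd us' = hd vs'" using us' vs' by simp
  have "length us' = length vs'"
    using is_cycle_length_le[OF us'(1) ch(2) hd] is_cycle_length_le[OF vs'(1) ch(1) hd[symmetric]]
    by simp
  then have "us' = vs'" using is_chain_prefix[OF ch hd] by simp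
  then show ?thesis using us' vs' by simp
qed

lemma canonical_meet:
  assumes inj: "inj_on \<pi> {1..k}"
    and xy: "x \<in> canonical k \<pi>" "y \<in> canonical k \<pi>" "a \<in> elements x" "a \<in> elements y"
  shows "x = y"
proof -
  have *: "x = y" if x: "x = Cycle (rotations us)" "is_cycle k \<pi> us"
    and y: "y \<in> canonical k \<pi>" and a: "a \<in> elements x" "a \<in> elements y" for x y us
  proof -
    have aus: "a \<in> set us" using x a by simp
    from y consider vs where "y = Cycle (rotations vs)" "is_cycle k \<pi> vs"
      | vs where "y = Path vs" "is_path k \<pi> vs"
      by (auto simp: canonical_def)
    then show ?thesis
    proof cases
      case 1
      then have "a \<in> set vs" using a by simp
      then show ?thesis using cycles_meet[OF x(2) 1(2) aus] x 1 by simp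
    next
      case 2
      then have "a \<in> set vs" using a by simp
      then show ?thesis using cycle_path_disjoint[OF x(2) 2(2)] aus by blast
    qed
  qed
  show ?thesis
  proof (cases "\<exists>us. (x = Cycle (rotations us) \<or> y = Cycle (rotations us)) \<and> is_cycle k \<pi> us")
    case True
    then show ?thesis using *[OF _ _ xy(2-4)] *[OF _ _ xy(1,4,3)] by metis
  next
    case False
    then obtain us vs where us: "x = Path us" "is_path k \<pi> us" "hd us \<notin> \<pi> ` {1..k}"
      and vs: "y = Path vs" "is_path k \<pi> vs" "hd vs \<notin> \<pi> ` {1..k}"
      using xy(1,2) unfolding canonical_def Un_iff mem_Collect_eq by metis
    have "a \<in> set us" "a \<in> set vs" using us vs xy by simp_all
    then obtain i j where ij: "i < length us" "j < length vs" "us ! i = vs ! j"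
      by (metis in_set_conv_nth)
    show ?thesis
    proof (cases "i \<le> j")
      case True
      then show ?thesis using canonical_paths_meet[OF inj us(2,3) vs(2,3) ij] us vs by simp
    next
      case False
      then show ?thesis
        using canonical_paths_meet[OF inj vs(2,3) us(2,3) ij(2,1) ij(3)[symmetric]] us vs by simp
    qed
  qed
qed

lemma canonical_covers:
  assumes inj: "inj_on \<pi> {1..k}" and a: "a \<in> {1..k}"
  shows "\<exists>x\<in>canonical k \<pi>. a \<in> elements x"
proof -
  define S where "S = {us. is_chain k \<pi> us \<and> a \<in> set us}"
  have "S \<subseteq> {us. set us \<subseteq> {1..k} \<and> distinct us}" by (auto simp: S_def is_chain_def)
  moreover have "finite {us. set us \<subseteq> {1..k} \<and> distinct us}"
    by (rule finite_subset_distinct) simp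
  ultimately have fin: "finite S" by (rule finite_subset)
  have "[a] \<in> S" using a by (simp add: S_def is_chain_def)
  then have "Max (length ` S) \<in> length ` S" using fin by (intro Max_in) auto
  then obtain us where us: "us \<in> S" "length us = Max (length ` S)" by auto
  have max: "length vs \<le> length us" if "vs \<in> S" for vs
    using that fin us(2) by simp
  have ch: "is_chain k \<pi> us" and aus: "a \<in> set us" using us(1) by (auto simp: S_def)
  then have ne: "us \<noteq> []" and sub: "set us \<subseteq> {1..k}" and dist: "distinct us"
    by (auto simp: is_chain_def)
  show ?thesis
  proof (cases "\<pi> (last us) \<in> {1..k}")
    case True
    have "\<pi> (last us) \<in> set us"
    proof (rule ccontr)
      assume new: "\<pi> (last us) \<notin> set us"
      have "\<pi> ((us @ [\<pi> (last us)]) ! t) = (us @ [\<pi> (last us)]) ! Suc t" if "t < length us" for t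
      proof (cases "Suc t < length us")
        case True
        then show ?thesis using ch by (simp add: is_chain_def nth_append)
      next
        case False
        then have "length us = Suc t" using that by simp
        then show ?thesis using ne by (simp add: nth_append last_conv_nth)
      qed
      then have "us @ [\<pi> (last us)] \<in> S"
        using True new ch aus by (simp add: S_def is_chain_def)
      from max[OF this] show False by simp
    qed
    then obtain j where j: "j < length us" "us ! j = \<pi> (last us)" by (auto simp: in_set_conv_nth)
    have "j = 0"
    proof (rule ccontr)
      assume "j \<noteq> 0"
      then obtain m where m: "j = Suc m" by (cases j) auto
      then have "\<pi> (us ! m) = \<pi> (last us)" using ch j by (auto simp: is_chain_def)
      moreover have "us ! m \<in> {1..k}" "last us \<in> {1..k}"
        using j m sub ne by (meson Suc_lessD nth_mem subsetD, meson last_in_set subsetD)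
      ultimately have "us ! m = us ! (length us - 1)"
        using inj ne by (simp add: inj_on_eq_iff last_conv_nth)
      then show False using dist j m ne by (auto simp: nth_eq_iff_index_eq)
    qed
    then have "is_cycle k \<pi> us" using ch j ne by (simp add: is_cycle_def hd_conv_nth)
    then have "Cycle (rotations us) \<in> canonical k \<pi>" by (auto simp: canonical_def)
    then show ?thesis using aus by (metis elements_Cycle_rotations)
  next
    case False
    have "hd us \<notin> \<pi> ` {1..k}"
    proof
      assume "hd us \<in> \<pi> ` {1..k}"
      then obtain v where v: "v \<in> {1..k}" "\<pi> v = hd us" by auto
      have "v \<notin> set us"
      proof
        assume "v \<in> set us"
        then obtain t where t: "t < length us" "us ! t = v" by (auto simp: in_set_conv_nth)
        have "\<not> Suc t < length us" using hd_not_inner[OF ch] t v by auto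
        then have "length us = Suc t" using t by simp
        then have "v = last us" using t ne by (simp add: last_conv_nth)
        then show False using False v sub ne by (metis hd_in_set subsetD)
      qed
      moreover have "\<pi> ((v # us) ! t) = (v # us) ! Suc t" if "t < length us" for t
        using that ch v ne by (cases t) (auto simp: is_chain_def hd_conv_nth)
      ultimately have "v # us \<in> S" using v ch aus by (simp add: S_def is_chain_def)
      from max[OF this] show False by simp
    qed
    then have "Path us \<in> canonical k \<pi>" using False ch by (auto simp: canonical_def is_path_def)
    then show ?thesis using aus by (metis elements.simps(2))
  qed
qed

lemma is_decomposition_canonical:
  assumes "inj_on \<pi> {1..k}"
  shows "is_decomposition k \<pi> (canonical k \<pi>)"
proof -
  have "elements x \<subseteq> {1..k}" if "x \<in> canonical k \<pi>" for x
    using that by (auto simp: canonical_def is_cycle_def is_path_def is_chain_def)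
  then have "(\<Union>x\<in>canonical k \<pi>. elements x) = {1..k}"
    using canonical_covers[OF assms] by blast
  moreover have "disjoint_family_on elements (canonical k \<pi>)"
    using canonical_meet[OF assms] unfolding disjoint_family_on_def by blast
  ultimately show ?thesis using canonical_subset by (simp add: is_decomposition_def)
qed

lemma elements_nonempty: "x \<in> components k \<pi> \<Longrightarrow> elements x \<noteq> {}"
  by (auto simp: components_def is_cycle_def is_path_def is_chain_def)

lemma is_decomposition_unique:
  assumes inj: "inj_on \<pi> {1..k}" and D: "is_decomposition k \<pi> D"
  shows "D = canonical k \<pi>"
proof -
  have comp: "D \<subseteq> components k \<pi>" and disj: "disjoint_family_on elements D"
    and cover: "(\<Union>x\<in>D. elements x) = {1..k}"
    using D by (auto simp: is_decomposition_def)
  have sub: "D \<subseteq> canonical k \<pi>"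
  proof
    fix x assume x: "x \<in> D"
    then consider us where "x = Cycle (rotations us)" "is_cycle k \<pi> us"
      | us where "x = Path us" "is_path k \<pi> us"
      using comp by (auto simp: components_def)
    then show "x \<in> canonical k \<pi>"
    proof cases
      case 1
      then show ?thesis by (auto simp: canonical_def)
    next
      case 2
      have ch: "is_chain k \<pi> us" using 2 by (simp add: is_path_def)
      then have ne: "us \<noteq> []" and hdk: "hd us \<in> {1..k}"
        using hd_in_set[of us] unfolding is_chain_def by blast+
      have "hd us \<notin> \<pi> ` {1..k}"
      proof
        assume "hd us \<in> \<pi> ` {1..k}"
        then obtain v where v: "v \<in> {1..k}" "\<pi> v = hd us" by auto
        obtain y where y: "y \<in> D" "v \<in> elements y" using v cover by blast
        have "hd us \<in> elements y"
          using closed_component[of y k \<pi> v] y v comp hdk by auto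
        moreover have "hd us \<in> elements x" using 2 ne by simp
        ultimately have "y = x" using disj x y unfolding disjoint_family_on_def by blast
        then have "v \<in> set us" using y 2 by simp
        then obtain t where t: "t < length us" "us ! t = v" by (auto simp: in_set_conv_nth)
        have "\<not> Suc t < length us" using hd_not_inner[OF ch] t v by auto
        then have "length us = Suc t" using t by simp
        then have "v = last us" using t ne by (simp add: last_conv_nth)
        then show False using 2 v hdk by (simp add: is_path_def)
      qed
      then show ?thesis using 2 by (auto simp: canonical_def)
    qed
  qed
  moreover have "canonical k \<pi> \<subseteq> D"
  proof
    fix x assume x: "x \<in> canonical k \<pi>"
    then obtain a where a: "a \<in> elements x"
      using elements_nonempty canonical_subset by blast
    then have "a \<in> {1..k}"
      using is_decomposition_canonical[OF inj] x by (auto simp: is_decomposition_def)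
    then obtain y where y: "y \<in> D" "a \<in> elements y" using cover by blast
    then have "x = y" using canonical_meet[OF inj x] sub a by blast
    then show "x \<in> D" using y by simp
  qed
  ultimately show ?thesis by blast
qed

lemma ex1_decomposition:
  assumes "\<pi> \<in> k_perms n k"
  shows "\<exists>!D. is_decomposition k \<pi> D"
proof -
  have "inj_on \<pi> {1..k}" using assms by (simp add: k_perms_def)
  then show ?thesis using is_decomposition_canonical is_decomposition_unique by blast
qed

end

theory Submission
  imports Defs "HOL-Combinatorics.Permutations"
begin

text \<open>
  A permutation $\sigma$ of $[n]$ with $\sigma([k]) = [k]$ acts on $A(n,k)$ by the automorphism
  $\rho \mapsto \sigma \circ \rho \circ \sigma^{-1}$, which preserves cycle types. Two
  $k$-permutations of the same cycle type are conjugate in this way: map the components of the one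
  to components of the other of the same kind and length, element by element, and extend the map
  beyond $[k]$, first to the end points $\pi(u_\ell) \notin [k]$ of the paths and then arbitrarily.
  So the cycle-type classes are orbits of a group of automorphisms, and such partitions are
  equitable.
\<close>

section \<open>Shapes of components\<close>

lemma decomposition_eq_canonical:
  assumes "inj_on \<pi> {1..k}"
  shows "decomposition k \<pi> = canonical k \<pi>"
  unfolding decomposition_def
  using is_decomposition_canonical[OF assms] is_decomposition_unique[OF assms]
  by (rule the_equality)

text \<open>Components that share an element coincide and none is empty, so a component is
  determined by its set of elements, a subset of [k].\<close>

lemma finite_canonical:
  assumes "inj_on \<pi> {1..k}"
  shows "finite (canonical k \<pi>)"
proof (rule inj_on_finite)
  show "inj_on elements (canonical k \<pi>)"
  proof (rule inj_onI)
    fix x y assume xy: "x \<in> canonical k \<pi>" "y \<in> canonical k \<pi>" "elements x = elements y"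
    obtain a where "a \<in> elements x"
      using elements_nonempty canonical_subset xy(1) by blast
    then show "x = y" using canonical_meet[OF assms xy(1,2)] xy(3) by simp
  qed
  show "elements ` canonical k \<pi> \<subseteq> Pow {1..k}"
    using is_decomposition_canonical[OF assms] by (auto simp: is_decomposition_def)
qed simp

text \<open>The length is read off as a number of elements, so that a cycle needs no choice of a
  representing list.\<close>

fun shape :: "component \<Rightarrow> bool \<times> nat" where
  "shape (Cycle R) = (True, card (elements (Cycle R)))"
| "shape (Path us) = (False, card (elements (Path us)))"

definition shape_count :: "nat \<Rightarrow> (nat \<Rightarrow> nat) \<Rightarrow> bool \<times> nat \<Rightarrow> nat" where
  "shape_count k \<pi> s = card {x \<in> canonical k \<pi>. shape x = s}"

text \<open>Lists that represent components are distinct, so their lengths are the cardinalities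
  recorded in the shape. Afterwards cycles and paths can be counted by one function.\<close>

lemma cycle_type_eq_shape_count:
  assumes "inj_on \<pi> {1..k}"
  shows "cycle_type k \<pi> = (\<lambda>l. shape_count k \<pi> (True, l), \<lambda>l. shape_count k \<pi> (False, l))"
proof -
  have len: "length us = card (set us)" if "is_cycle k \<pi> us \<or> is_path k \<pi> us" for us
    using that by (auto simp: is_cycle_def is_path_def is_chain_def distinct_card)
  have "{x \<in> canonical k \<pi>. \<exists>us. x = Cycle (rotations us) \<and> length us = l}
      = {x \<in> canonical k \<pi>. shape x = (True, l)}" for l
  proof (intro Collect_cong conj_cong refl iffI)
    fix x assume x: "x \<in> canonical k \<pi>" "shape x = (True, l)"
    then obtain us where us: "x = Cycle (rotations us)" "is_cycle k \<pi> us"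
      by (auto simp: canonical_def)
    then show "\<exists>us. x = Cycle (rotations us) \<and> length us = l"
      using x len[of us] by auto
  next
    fix x assume x: "x \<in> canonical k \<pi>" "\<exists>us. x = Cycle (rotations us) \<and> length us = l"
    then obtain us where us: "x = Cycle (rotations us)" "length us = l" by blast
    obtain vs where vs: "x = Cycle (rotations vs)" "is_cycle k \<pi> vs"
      using x us by (auto simp: canonical_def)
    \<comment> \<open>The list \<open>us\<close> is not yet known to be a cycle; equality of the two
      rotation classes makes it a rotation of the cycle \<open>vs\<close>, hence of the same
      length.\<close>
    have "us \<in> rotations vs" using us vs rotations_self[of us] by simp
    then have "length us = length vs" by (auto simp: rotations_def)
    then show "shape x = (True, l)" using us(2) vs len[of vs] by simp
  qed
  moreover have "{x \<in> canonical k \<pi>. \<exists>us. x = Path us \<and> length us = l}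
      = {x \<in> canonical k \<pi>. shape x = (False, l)}" for l
    using len by (auto simp: canonical_def)
  ultimately show ?thesis
    by (simp add: cycle_type_def num_cycles_def[abs_def] num_paths_def[abs_def] shape_count_def
        decomposition_eq_canonical[OF assms])
qed

lemma cycle_type_eq_iff:
  assumes "inj_on \<pi> {1..k}" "inj_on \<rho> {1..k}"
  shows "cycle_type k \<pi> = cycle_type k \<rho> \<longleftrightarrow> shape_count k \<pi> = shape_count k \<rho>"
  unfolding cycle_type_eq_shape_count[OF assms(1)] cycle_type_eq_shape_count[OF assms(2)]
  by (simp add: fun_eq_iff split_paired_all all_bool_eq)

section \<open>Conjugation preserves the cycle type\<close>

text \<open>The equation \<rho> = \<sigma> \<pi> \<sigma>^-1 on [k], written without the inverse.
  The map \<sigma> has to live beyond [k], because \<pi> may take values there.\<close>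

definition conjugates :: "nat \<Rightarrow> (nat \<Rightarrow> nat) \<Rightarrow> (nat \<Rightarrow> nat) \<Rightarrow> (nat \<Rightarrow> nat) \<Rightarrow> bool" where
  "conjugates k \<sigma> \<pi> \<rho> \<longleftrightarrow>
     bij \<sigma> \<and> \<sigma> ` {1..k} = {1..k} \<and> (\<forall>a\<in>{1..k}. \<rho> (\<sigma> a) = \<sigma> (\<pi> a))"

lemma conjugates_mem_iff: "conjugates k \<sigma> \<pi> \<rho> \<Longrightarrow> \<sigma> a \<in> {1..k} \<longleftrightarrow> a \<in> {1..k}"
  unfolding conjugates_def by (metis bij_is_inj inj_image_mem_iff)

text \<open>Symmetry of conjugacy turns inequalities between shape counts into equalities and later
  provides a left inverse of conjugation.\<close>

lemma conjugates_inv: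
  assumes "conjugates k \<sigma> \<pi> \<rho>"
  shows "conjugates k (inv \<sigma>) \<rho> \<pi>"
proof -
  have \<sigma>: "bij \<sigma>" "\<sigma> ` {1..k} = {1..k}" and c: "\<And>a. a \<in> {1..k} \<Longrightarrow> \<rho> (\<sigma> a) = \<sigma> (\<pi> a)"
    using assms by (auto simp: conjugates_def)
  have inv: "inv \<sigma> (\<sigma> a) = a" for a using \<sigma>(1) by (simp add: bij_is_inj)
  have "inv \<sigma> ` {1..k} = {1..k}"
    using \<sigma> by (metis bij_is_inj image_inv_f_f)
  moreover have "\<pi> (inv \<sigma> b) = inv \<sigma> (\<rho> b)" if b: "b \<in> {1..k}" for b
  proof -
    obtain a where "a \<in> {1..k}" "b = \<sigma> a" using b \<sigma>(2) by blast
    then show ?thesis by (simp add: inv c)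
  qed
  ultimately show ?thesis using \<sigma>(1) by (simp add: conjugates_def bij_imp_bij_inv)
qed

lemma is_chain_map:
  assumes "conjugates k \<sigma> \<pi> \<rho>" "is_chain k \<pi> us"
  shows "is_chain k \<rho> (map \<sigma> us)"
proof -
  have us: "us ! t \<in> {1..k}" if "t < length us" for t
    using assms(2) that unfolding is_chain_def by (meson nth_mem subsetD)
  have "\<sigma> ` set us \<subseteq> {1..k}"
    using assms unfolding is_chain_def conjugates_def by blast
  moreover have "inj_on \<sigma> (set us)"
    using assms(1) by (auto simp: conjugates_def bij_def intro: inj_on_subset)
  ultimately show ?thesis
    using assms us by (auto simp: is_chain_def distinct_map conjugates_def)
qed

lemma conjugates_last:
  assumes "conjugates k \<sigma> \<pi> \<rho>" "is_chain k \<pi> us"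
  shows "\<rho> (last (map \<sigma> us)) = \<sigma> (\<pi> (last us))"
proof -
  have "us \<noteq> []" "last us \<in> {1..k}"
    using assms(2) last_in_set unfolding is_chain_def by blast+
  then show ?thesis using assms(1) by (simp add: last_map conjugates_def)
qed

lemma is_cycle_map:
  assumes "conjugates k \<sigma> \<pi> \<rho>" "is_cycle k \<pi> us"
  shows "is_cycle k \<rho> (map \<sigma> us)"
  using assms is_chain_map[OF assms(1)] conjugates_last[OF assms(1)]
  by (auto simp: is_cycle_def is_chain_def hd_map)

text \<open>As a bijection that maps [k] onto itself, \<sigma> sends the end point of a path outside
  [k] to a point outside [k].\<close>

lemma is_path_map:
  assumes "conjugates k \<sigma> \<pi> \<rho>" "is_path k \<pi> us"
  shows "is_path k \<rho> (map \<sigma> us)"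
  using assms is_chain_map[OF assms(1)] conjugates_last[OF assms(1)]
    conjugates_mem_iff[OF assms(1)]
  unfolding is_path_def by metis

text \<open>The whole rotation class of a cycle is mapped list by list, which avoids choosing a
  starting point.\<close>

fun map_elements :: "(nat \<Rightarrow> nat) \<Rightarrow> component \<Rightarrow> component" where
  "map_elements \<sigma> (Cycle R) = Cycle (map \<sigma> ` R)"
| "map_elements \<sigma> (Path us) = Path (map \<sigma> us)"

lemma map_rotations: "map \<sigma> ` rotations us = rotations (map \<sigma> us)"
  by (simp add: rotations_def image_image rotate_map)

lemma elements_map_elements: "elements (map_elements \<sigma> x) = \<sigma> ` elements x"
  by (cases x) (auto simp: elements.simps(1))

lemma shape_map_elements:
  assumes "inj \<sigma>"
  shows "shape (map_elements \<sigma> x) = shape x"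
proof -
  have "card (elements (map_elements \<sigma> x)) = card (elements x)"
    using assms by (simp add: elements_map_elements card_image inj_on_subset)
  then show ?thesis by (cases x) simp_all
qed

lemma inj_map_elements:
  assumes "inj \<sigma>"
  shows "inj (map_elements \<sigma>)"
proof (rule injI)
  fix x y assume "map_elements \<sigma> x = map_elements \<sigma> y"
  then show "x = y"
    using assms by (cases x; cases y) (auto simp: inj_image_eq_iff)
qed

text \<open>Chains, cycles and paths are carried along by \<sigma>. Maximality of a path survives
  too: the image of \<rho> is the \<sigma>-image of the image of \<pi>, so a start without a
  predecessor goes to a start without a predecessor.\<close>

lemma map_elements_canonical:
  assumes conj: "conjugates k \<sigma> \<pi> \<rho>" and x: "x \<in> canonical k \<pi>"
  shows "map_elements \<sigma> x \<in> canonical k \<rho>"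
proof -
  from x consider us where "x = Cycle (rotations us)" "is_cycle k \<pi> us"
    | us where "x = Path us" "is_path k \<pi> us" "hd us \<notin> \<pi> ` {1..k}"
    by (auto simp: canonical_def)
  then show ?thesis
  proof cases
    case 1
    then show ?thesis
      using is_cycle_map[OF conj 1(2)] by (auto simp: map_rotations canonical_def)
  next
    case 2
    have "us \<noteq> []" using 2 by (auto simp: is_path_def is_chain_def)
    moreover have "\<rho> ` {1..k} = \<sigma> ` \<pi> ` {1..k}"
    proof -
      have "\<rho> ` {1..k} = \<rho> ` \<sigma> ` {1..k}" using conj by (simp add: conjugates_def)
      also have "\<dots> = \<sigma> ` \<pi> ` {1..k}"
        using conj unfolding image_image conjugates_def by (intro image_cong) auto
      finally show ?thesis .
    qed
    ultimately have "hd (map \<sigma> us) \<notin> \<rho> ` {1..k}"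
      using 2 conj by (simp add: hd_map conjugates_def bij_def inj_image_mem_iff)
    then show ?thesis using is_path_map[OF conj 2(2)] 2 by (auto simp: canonical_def)
  qed
qed

text \<open>The injection \<open>map_elements \<sigma>\<close> carries the components of \<pi> to
  components of \<rho> and preserves their shape.\<close>

lemma shape_count_le:
  assumes "conjugates k \<sigma> \<pi> \<rho>" "inj_on \<rho> {1..k}"
  shows "shape_count k \<pi> s \<le> shape_count k \<rho> s"
  unfolding shape_count_def
proof (rule card_inj_on_le)
  have inj: "inj \<sigma>" using assms(1) by (simp add: conjugates_def bij_def)
  show "inj_on (map_elements \<sigma>) {x \<in> canonical k \<pi>. shape x = s}"
    using inj_map_elements[OF inj] by (rule inj_on_subset) simp
  show "map_elements \<sigma> ` {x \<in> canonical k \<pi>. shape x = s} \<subseteq> {x \<in> canonical k \<rho>. shape x = s}"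
    using map_elements_canonical[OF assms(1)] shape_map_elements[OF inj] by auto
  show "finite {x \<in> canonical k \<rho>. shape x = s}"
    using finite_canonical[OF assms(2)] by simp
qed

lemma cycle_type_conjugates:
  assumes "conjugates k \<sigma> \<pi> \<rho>" "inj_on \<pi> {1..k}" "inj_on \<rho> {1..k}"
  shows "cycle_type k \<pi> = cycle_type k \<rho>"
  using shape_count_le[OF assms(1,3)] shape_count_le[OF conjugates_inv[OF assms(1)] assms(2)]
  by (simp add: cycle_type_eq_iff[OF assms(2,3)] fun_eq_iff order_antisym)

section \<open>Equal cycle types imply conjugacy\<close>

text \<open>Corresponding fibres have equal size, so bijections between them exist; glued together
  they stay injective because the image of a point reveals its fibre. This will match components of
  equal shape.\<close>

lemma fibrewise_bij_betw:
  assumes "finite A" "finite B"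
    and "\<And>s. card {x \<in> A. h x = s} = card {y \<in> B. h' y = s}"
  obtains f where "bij_betw f A B" "\<And>x. x \<in> A \<Longrightarrow> h' (f x) = h x"
proof -
  have "\<exists>g. bij_betw g {x \<in> A. h x = s} {y \<in> B. h' y = s}" for s
    using assms by (intro finite_same_card_bij) auto
  then obtain g where g: "\<And>s. bij_betw (g s) {x \<in> A. h x = s} {y \<in> B. h' y = s}"
    by metis
  define f where "f x = g (h x) x" for x
  have f: "f x \<in> B" "h' (f x) = h x" if "x \<in> A" for x
    using bij_betwE[OF g[of "h x"]] that by (auto simp: f_def)
  have "inj_on f A"
  proof (rule inj_onI)
    fix x y assume xy: "x \<in> A" "y \<in> A" "f x = f y"
    then have "h x = h y" using f(2) by metis
    then show "x = y"
      using bij_betw_imp_inj_on[OF g[of "h x"]] xy by (auto simp: f_def dest: inj_onD)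
  qed
  moreover have "y \<in> f ` A" if "y \<in> B" for y
  proof -
    have "y \<in> g (h' y) ` {x \<in> A. h x = h' y}"
      using bij_betw_imp_surj_on[OF g[of "h' y"]] that by simp
    then show ?thesis by (force simp: f_def)
  qed
  ultimately have "bij_betw f A B" using f(1) by (auto simp: bij_betw_def)
  then show thesis using f(2) that by blast
qed

section \<open>Coordinates on [k]: a component and an index in it\<close>

text \<open>For a cycle this chooses a starting point; for a path it is the list of the path
  itself.\<close>

definition listing :: "nat \<Rightarrow> (nat \<Rightarrow> nat) \<Rightarrow> component \<Rightarrow> nat list" where
  "listing k \<pi> x = (SOME us. x = Cycle (rotations us) \<and> is_cycle k \<pi> us \<or>
     x = Path us \<and> is_path k \<pi> us)"

lemma listing:
  assumes "x \<in> canonical k \<pi>"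
  shows "x = Cycle (rotations (listing k \<pi> x)) \<and> is_cycle k \<pi> (listing k \<pi> x) \<or>
    x = Path (listing k \<pi> x) \<and> is_path k \<pi> (listing k \<pi> x)"
  unfolding listing_def by (rule someI_ex) (use assms in \<open>auto simp: canonical_def\<close>)

lemma is_chain_listing: "x \<in> canonical k \<pi> \<Longrightarrow> is_chain k \<pi> (listing k \<pi> x)"
  using listing[of x k \<pi>] by (auto simp: is_cycle_def is_path_def)

lemma set_listing: "x \<in> canonical k \<pi> \<Longrightarrow> set (listing k \<pi> x) = elements x"
  using listing[of x k \<pi>] by (metis elements_Cycle_rotations elements.simps(2))

lemma length_listing:
  assumes "x \<in> canonical k \<pi>"
  shows "length (listing k \<pi> x) = snd (shape x)"
proof -
  have "length (listing k \<pi> x) = card (elements x)"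
    using is_chain_listing[OF assms] set_listing[OF assms]
    by (metis distinct_card is_chain_def)
  then show ?thesis by (cases x) simp_all
qed

text \<open>The behaviour of \<pi> at the last entry depends on the shape alone, so it agrees for
  matched components of two different maps.\<close>

lemma listing_last:
  assumes "x \<in> canonical k \<pi>" "length (listing k \<pi> x) = Suc t"
  shows "if fst (shape x) then \<pi> (listing k \<pi> x ! t) = listing k \<pi> x ! 0
    else \<pi> (listing k \<pi> x ! t) \<notin> {1..k}"
proof -
  have ne: "listing k \<pi> x \<noteq> []" using assms(2) by auto
  then have "last (listing k \<pi> x) = listing k \<pi> x ! t" "hd (listing k \<pi> x) = listing k \<pi> x ! 0"
    using assms(2) by (simp_all add: last_conv_nth hd_conv_nth)
  moreover have "fst (shape x) \<longleftrightarrow> (\<exists>R. x = Cycle R)" by (cases x) simp_all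
  ultimately show ?thesis
    using listing[OF assms(1)] by (auto simp: is_cycle_def is_path_def)
qed

definition positions :: "nat \<Rightarrow> (nat \<Rightarrow> nat) \<Rightarrow> (component \<times> nat) set" where
  "positions k \<pi> = Sigma (canonical k \<pi>) (\<lambda>x. {..<length (listing k \<pi> x)})"

definition entry :: "nat \<Rightarrow> (nat \<Rightarrow> nat) \<Rightarrow> component \<times> nat \<Rightarrow> nat" where
  "entry k \<pi> p = listing k \<pi> (fst p) ! snd p"

text \<open>The components partition [k] and each listing is distinct, so every element of [k] has
  exactly one component and one index.\<close>

lemma bij_betw_entry:
  assumes inj: "inj_on \<pi> {1..k}"
  shows "bij_betw (entry k \<pi>) (positions k \<pi>) {1..k}"
proof (rule bij_betw_imageI)
  have mem: "entry k \<pi> (x, t) \<in> elements x" if "(x, t) \<in> positions k \<pi>" for x t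
    using that nth_mem[of t "listing k \<pi> x"] by (auto simp: positions_def entry_def set_listing)
  show "inj_on (entry k \<pi>) (positions k \<pi>)"
  proof (rule inj_onI, clarify)
    fix x s y t
    assume p: "(x, s) \<in> positions k \<pi>" "(y, t) \<in> positions k \<pi>"
      and eq: "entry k \<pi> (x, s) = entry k \<pi> (y, t)"
    have "x = y"
      using canonical_meet[OF inj, of x y] mem[OF p(1)] mem[OF p(2)] eq p
      by (auto simp: positions_def)
    moreover have "distinct (listing k \<pi> x)"
      using is_chain_listing[of x k \<pi>] p by (auto simp: positions_def is_chain_def)
    ultimately show "x = y \<and> s = t"
      using p eq by (auto simp: positions_def entry_def nth_eq_iff_index_eq)
  qed
  show "entry k \<pi> ` positions k \<pi> = {1..k}"
  proof
    show "entry k \<pi> ` positions k \<pi> \<subseteq> {1..k}"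
      using mem is_decomposition_canonical[OF inj]
      by (fastforce simp: is_decomposition_def positions_def)
    show "{1..k} \<subseteq> entry k \<pi> ` positions k \<pi>"
    proof
      fix a assume "a \<in> {1..k}"
      then obtain x where x: "x \<in> canonical k \<pi>" "a \<in> elements x"
        using canonical_covers[OF inj] by blast
      then obtain t where "t < length (listing k \<pi> x)" "listing k \<pi> x ! t = a"
        by (metis set_listing in_set_conv_nth)
      then have "(x, t) \<in> positions k \<pi>" "a = entry k \<pi> (x, t)"
        using x by (auto simp: positions_def entry_def)
      then show "a \<in> entry k \<pi> ` positions k \<pi>" by blast
    qed
  qed
qed

section \<open>Construction of the conjugating permutation\<close>

text \<open>Match the components by shape and send each entry to the entry with the same index in
  the matched component. Where \<pi> leaves [k], \<tau> has no prescribed value at the end point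
  yet, so all that is claimed is that \<rho> leaves [k] at the corresponding place.\<close>

lemma conjugate_on_domain:
  assumes inj: "inj_on \<pi> {1..k}" "inj_on \<rho> {1..k}"
    and type: "cycle_type k \<pi> = cycle_type k \<rho>"
  obtains \<tau> where "bij_betw \<tau> {1..k} {1..k}"
    "\<And>a. a \<in> {1..k} \<Longrightarrow>
      if \<pi> a \<in> {1..k} then \<rho> (\<tau> a) = \<tau> (\<pi> a) else \<rho> (\<tau> a) \<notin> {1..k}"
proof -
  have "shape_count k \<pi> s = shape_count k \<rho> s" for s
    using type by (simp add: cycle_type_eq_iff[OF inj])
  then obtain f where f: "bij_betw f (canonical k \<pi>) (canonical k \<rho>)"
    and shape: "\<And>x. x \<in> canonical k \<pi> \<Longrightarrow> shape (f x) = shape x"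
    using fibrewise_bij_betw[OF finite_canonical[OF inj(1)] finite_canonical[OF inj(2)],
        of shape shape]
    unfolding shape_count_def by metis
  have fx: "f x \<in> canonical k \<rho>" if "x \<in> canonical k \<pi>" for x
    using f that by (rule bij_betw_apply)
  have len: "length (listing k \<rho> (f x)) = length (listing k \<pi> x)" if "x \<in> canonical k \<pi>" for x
    using that fx shape by (simp add: length_listing)
  define F where "F = map_prod f (id :: nat \<Rightarrow> nat)"
  have F: "bij_betw F (positions k \<pi>) (positions k \<rho>)"
  proof (rule bij_betw_imageI)
    show "inj_on F (positions k \<pi>)"
      using bij_betw_imp_inj_on[OF f]
      by (auto simp: F_def positions_def inj_on_def)
    have "(y, t) \<in> F ` positions k \<pi>" if q: "(y, t) \<in> positions k \<rho>" for y t
    proof -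
      obtain x where "x \<in> canonical k \<pi>" "y = f x"
        using q bij_betw_imp_surj_on[OF f] unfolding positions_def by blast
      then have "(x, t) \<in> positions k \<pi>" "(y, t) = F (x, t)"
        using q len by (auto simp: positions_def F_def)
      then show ?thesis by blast
    qed
    then show "F ` positions k \<pi> = positions k \<rho>"
      by (auto simp: F_def positions_def fx len)
  qed
  note entry = bij_betw_entry[OF inj(1)] bij_betw_entry[OF inj(2)]
  \<comment> \<open>In coordinates, \<tau> replaces the component by its match under
    \<open>f\<close> and keeps the index.\<close>
  define \<tau> where "\<tau> = entry k \<rho> \<circ> (F \<circ> inv_into (positions k \<pi>) (entry k \<pi>))"
  have \<tau>: "\<tau> (entry k \<pi> (x, t)) = entry k \<rho> (f x, t)" if "(x, t) \<in> positions k \<pi>" for x t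
    using that bij_betw_imp_inj_on[OF entry(1)] by (simp add: \<tau>_def F_def)
  show thesis
  proof
    show "bij_betw \<tau> {1..k} {1..k}"
      unfolding \<tau>_def using bij_betw_inv_into[OF entry(1)] F entry(2)
      by (intro bij_betw_trans)
    fix a assume "a \<in> {1..k}"
    then obtain x t where p: "(x, t) \<in> positions k \<pi>" and a: "a = entry k \<pi> (x, t)"
      using bij_betw_imp_surj_on[OF entry(1)] by (metis imageE surj_pair)
    have x: "x \<in> canonical k \<pi>" and t: "t < length (listing k \<pi> x)"
      using p by (auto simp: positions_def)
    note chain = is_chain_listing[OF x] is_chain_listing[OF fx[OF x]]
    have in_k: "entry k \<pi> q \<in> {1..k}" if "q \<in> positions k \<pi>" for q
      using entry(1) that by (rule bij_betw_apply)
    show "if \<pi> a \<in> {1..k} then \<rho> (\<tau> a) = \<tau> (\<pi> a) else \<rho> (\<tau> a) \<notin> {1..k}"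
    proof (cases "Suc t < length (listing k \<pi> x)")
      case True
      have q: "(x, Suc t) \<in> positions k \<pi>" using True x by (simp add: positions_def)
      have "\<pi> a = entry k \<pi> (x, Suc t)"
        using chain(1) True by (simp add: a entry_def is_chain_def)
      moreover have "\<rho> (\<tau> a) = entry k \<rho> (f x, Suc t)"
        using chain(2) True len[OF x] \<tau>[OF p] by (simp add: a entry_def is_chain_def)
      ultimately show ?thesis using in_k[OF q] \<tau>[OF q] by simp
    next
      case False
      then have l: "length (listing k \<pi> x) = Suc t" using t by simp
      have q: "(x, 0) \<in> positions k \<pi>" using l x by (simp add: positions_def)
      \<comment> \<open>After its last entry a cycle returns to index 0 and a path leaves [k]. Since
        \<open>f\<close> preserves shapes, the same alternative occurs for \<rho> on
        \<open>f x\<close>.\<close>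
      have last: "if fst (shape x) then \<pi> a = entry k \<pi> (x, 0) else \<pi> a \<notin> {1..k}"
        using listing_last[OF x l] unfolding a entry_def fst_conv snd_conv .
      have "if fst (shape x) then \<rho> (\<tau> a) = entry k \<rho> (f x, 0) else \<rho> (\<tau> a) \<notin> {1..k}"
        using listing_last[OF fx[OF x], of t] len[OF x] l shape[OF x] \<tau>[OF p]
        unfolding a entry_def fst_conv snd_conv by metis
      then show ?thesis using last in_k[OF q] \<tau>[OF q] by (metis (full_types))
    qed
  qed
qed

text \<open>Inside the finite set \<open>U\<close> the complements of \<open>S\<close> and
  \<open>T\<close> have equal size, so any bijection between them completes
  \<open>f\<close>.\<close>

lemma bij_betw_extend_permutes:
  assumes "finite U" "S \<subseteq> U" "T \<subseteq> U" "bij_betw f S T"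
  obtains \<sigma> where "\<sigma> permutes U" "\<And>x. x \<in> S \<Longrightarrow> \<sigma> x = f x"
proof -
  have "card (U - S) = card (U - T)"
    using assms bij_betw_same_card[OF assms(4)] by (simp add: card_Diff_subset finite_subset)
  then obtain g where g: "bij_betw g (U - S) (U - T)"
    using finite_same_card_bij[of "U - S" "U - T"] assms(1) by auto
  define \<sigma> where "\<sigma> x = (if x \<in> S then f x else if x \<in> U then g x else x)" for x
  have "bij_betw (\<lambda>x. if x \<in> S then f x else g x) (S \<union> (U - S)) (T \<union> (U - T))"
    using assms(4) g by (rule bij_betw_disjoint_Un) auto
  moreover have "S \<union> (U - S) = U" "T \<union> (U - T) = U" using assms by auto
  ultimately have "bij_betw (\<lambda>x. if x \<in> S then f x else g x) U U" by simp
  then have "bij_betw \<sigma> U U"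
    by (rule bij_betw_cong[THEN iffD1, rotated]) (simp add: \<sigma>_def)
  then have "\<sigma> permutes U"
    by (rule bij_imp_permutes) (use assms(2) in \<open>auto simp: \<sigma>_def\<close>)
  then show thesis by (rule that) (simp add: \<sigma>_def)
qed

text \<open>Conjugacy forces the value \<open>\<rho> (\<tau> a)\<close> at an end point
  \<open>\<pi> a\<close> outside [k]. With these values \<tau> becomes a bijection between two
  subsets of [n], namely [k] together with the image of \<pi> and [k] together with the image of
  \<rho>, and this extends to a permutation of [n].\<close>

lemma conjugate_if_same_cycle_type:
  assumes \<pi>: "\<pi> \<in> k_perms n k" and \<rho>: "\<rho> \<in> k_perms n k" and "k \<le> n"
    and type: "cycle_type k \<pi> = cycle_type k \<rho>"
  obtains \<sigma> where "\<sigma> permutes {1..n}" "conjugates k \<sigma> \<pi> \<rho>"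
proof -
  have inj: "inj_on \<pi> {1..k}" "inj_on \<rho> {1..k}"
    and img: "\<pi> ` {1..k} \<subseteq> {1..n}" "\<rho> ` {1..k} \<subseteq> {1..n}"
    using \<pi> \<rho> by (auto simp: k_perms_def)
  obtain \<tau> where \<tau>: "bij_betw \<tau> {1..k} {1..k}"
    and comm: "\<And>a. a \<in> {1..k} \<Longrightarrow>
      if \<pi> a \<in> {1..k} then \<rho> (\<tau> a) = \<tau> (\<pi> a) else \<rho> (\<tau> a) \<notin> {1..k}"
    using conjugate_on_domain[OF inj type] by metis
  have \<tau>_in: "\<tau> a \<in> {1..k}" if "a \<in> {1..k}" for a using \<tau> that by (rule bij_betw_apply)
  \<comment> \<open>By injectivity of \<pi>, an end point \<open>b\<close> determines the
    \<open>a\<close> with \<open>b = \<pi> a\<close>, so the forced value is well defined.\<close>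
  define g where "g b = (if b \<in> {1..k} then \<tau> b else \<rho> (\<tau> (inv_into {1..k} \<pi> b)))" for b
  have g_\<pi>: "g (\<pi> a) = \<rho> (\<tau> a)" if "a \<in> {1..k}" for a
    using comm[OF that] inj(1) that by (simp add: g_def)
  \<comment> \<open>This separates the two branches of \<open>g\<close>: points inside and outside
    [k] cannot collide, so injectivity can be checked on each side, from \<tau> inside and from
    \<rho> and \<tau> outside.\<close>
  have g_in: "g b \<in> {1..k} \<longleftrightarrow> b \<in> {1..k}" if b: "b \<in> {1..k} \<union> \<pi> ` {1..k}" for b
  proof (cases "b \<in> {1..k}")
    case True
    then show ?thesis using \<tau>_in[OF True] by (simp add: g_def)
  next
    case False
    then obtain a where "a \<in> {1..k}" "b = \<pi> a" using b by blast
    then show ?thesis using False comm[of a] g_\<pi>[of a] by (simp del: atLeastAtMost_iff)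
  qed
  have "inj_on g ({1..k} \<union> \<pi> ` {1..k})"
  proof (rule inj_onI)
    fix b c assume b: "b \<in> {1..k} \<union> \<pi> ` {1..k}" and c: "c \<in> {1..k} \<union> \<pi> ` {1..k}"
      and eq: "g b = g c"
    show "b = c"
    proof (cases "b \<in> {1..k}")
      case True
      then have "c \<in> {1..k}" using g_in[OF b] g_in[OF c] eq by metis
      then show ?thesis
        using True eq bij_betw_imp_inj_on[OF \<tau>] by (simp add: g_def inj_on_eq_iff)
    next
      case False
      then have "c \<notin> {1..k}" using g_in[OF b] g_in[OF c] eq by metis
      then obtain a a' where a: "a \<in> {1..k}" "b = \<pi> a" "a' \<in> {1..k}" "c = \<pi> a'"
        using False b c by blast
      then have "\<rho> (\<tau> a) = \<rho> (\<tau> a')" using eq by (simp add: g_\<pi>)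
      then have "a = a'"
        using a \<tau>_in inj(2) bij_betw_imp_inj_on[OF \<tau>] by (metis inj_on_eq_iff)
      then show ?thesis using a by simp
    qed
  qed
  moreover have "g ` ({1..k} \<union> \<pi> ` {1..k}) = {1..k} \<union> \<rho> ` {1..k}"
  proof -
    have \<tau>_img: "\<tau> ` {1..k} = {1..k}" using \<tau> by (rule bij_betw_imp_surj_on)
    have "g ` \<pi> ` {1..k} = \<rho> ` \<tau> ` {1..k}"
      unfolding image_image by (intro image_cong) (simp_all add: g_\<pi>)
    moreover have "g ` {1..k} = \<tau> ` {1..k}" by (intro image_cong) (simp_all add: g_def)
    ultimately show ?thesis by (simp only: image_Un \<tau>_img)
  qed
  ultimately have "bij_betw g ({1..k} \<union> \<pi> ` {1..k}) ({1..k} \<union> \<rho> ` {1..k})"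
    by (rule bij_betw_imageI)
  moreover have "{1..k} \<union> \<pi> ` {1..k} \<subseteq> {1..n}" "{1..k} \<union> \<rho> ` {1..k} \<subseteq> {1..n}"
    using img \<open>k \<le> n\<close> by auto
  ultimately obtain \<sigma> where \<sigma>: "\<sigma> permutes {1..n}"
    and ext: "\<And>b. b \<in> {1..k} \<union> \<pi> ` {1..k} \<Longrightarrow> \<sigma> b = g b"
    using bij_betw_extend_permutes[of "{1..n}"] by (metis finite_atLeastAtMost)
  have \<sigma>_\<tau>: "\<sigma> a = \<tau> a" if "a \<in> {1..k}" for a using that ext[of a] by (simp add: g_def)
  have "\<sigma> ` {1..k} = {1..k}"
    using bij_betw_imp_surj_on[OF \<tau>] \<sigma>_\<tau> by (metis image_cong)
  moreover have "\<rho> (\<sigma> a) = \<sigma> (\<pi> a)" if "a \<in> {1..k}" for a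
    using that ext[of "\<pi> a"] by (simp add: \<sigma>_\<tau> g_\<pi>)
  ultimately have "conjugates k \<sigma> \<pi> \<rho>"
    using permutes_bij[OF \<sigma>] by (simp add: conjugates_def)
  then show thesis using \<sigma> that by blast
qed

section \<open>Automorphisms of the arrangement graph\<close>

text \<open>The restriction makes the result extensional, as elements of \<open>k_perms\<close> must
  be.\<close>

definition conjugate :: "nat \<Rightarrow> (nat \<Rightarrow> nat) \<Rightarrow> (nat \<Rightarrow> nat) \<Rightarrow> nat \<Rightarrow> nat" where
  "conjugate k \<sigma> \<pi> = restrict (\<sigma> \<circ> \<pi> \<circ> inv \<sigma>) {1..k}"

lemma conjugates_conjugate:
  assumes "bij \<sigma>" "\<sigma> ` {1..k} = {1..k}"
  shows "conjugates k \<sigma> \<pi> (conjugate k \<sigma> \<pi>)"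
proof -
  have "\<sigma> a \<in> {1..k}" if "a \<in> {1..k}" for a using assms(2) that by blast
  then show ?thesis
    using assms by (auto simp: conjugates_def conjugate_def bij_is_inj simp del: atLeastAtMost_iff)
qed

text \<open>Every point of [k] has the form \<open>\<sigma> a\<close> with \<open>a\<close> in [k],
  where the relation prescribes the value; extensionality settles the points outside [k].\<close>

lemma conjugate_eqI:
  assumes "conjugates k \<sigma> \<pi> \<rho>" "\<rho> \<in> extensional {1..k}"
  shows "conjugate k \<sigma> \<pi> = \<rho>"
proof (rule extensionalityI)
  show "conjugate k \<sigma> \<pi> \<in> extensional {1..k}" by (simp add: conjugate_def)
  fix b assume "b \<in> {1..k}"
  then obtain a where "a \<in> {1..k}" "b = \<sigma> a"
    using assms(1) unfolding conjugates_def by blast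
  moreover have "conjugates k \<sigma> \<pi> (conjugate k \<sigma> \<pi>)"
    using assms(1) by (intro conjugates_conjugate) (simp_all add: conjugates_def)
  ultimately show "conjugate k \<sigma> \<pi> b = \<rho> b" using assms(1) by (simp add: conjugates_def)
qed (fact assms(2))

text \<open>Stability of [k] under \<sigma> preserves the domain and stability of [n] preserves the
  range.\<close>

lemma conjugate_in_k_perms:
  assumes \<sigma>: "\<sigma> permutes {1..n}" "\<sigma> ` {1..k} = {1..k}" and \<pi>: "\<pi> \<in> k_perms n k"
  shows "conjugate k \<sigma> \<pi> \<in> k_perms n k"
proof -
  have bij: "bij \<sigma>" using \<sigma>(1) by (rule permutes_bij)
  have inv: "inv \<sigma> ` {1..k} = {1..k}" using bij \<sigma>(2) by (metis bij_is_inj image_inv_f_f)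
  have \<pi>': "inj_on \<pi> {1..k}" "\<pi> ` {1..k} \<subseteq> {1..n}" using \<pi> by (auto simp: k_perms_def)
  have "inj_on (\<sigma> \<circ> (\<pi> \<circ> inv \<sigma>)) {1..k}"
  proof (intro comp_inj_on)
    show "inj_on (inv \<sigma>) {1..k}"
      using bij by (meson bij_imp_bij_inv bij_is_inj inj_on_subset subset_UNIV)
    show "inj_on \<pi> (inv \<sigma> ` {1..k})" using inv \<pi>' by simp
    show "inj_on \<sigma> ((\<pi> \<circ> inv \<sigma>) ` {1..k})"
      using bij by (meson bij_is_inj inj_on_subset subset_UNIV)
  qed
  then have "inj_on (conjugate k \<sigma> \<pi>) {1..k}"
    by (simp add: conjugate_def inj_on_restrict_eq comp_assoc)
  moreover have "conjugate k \<sigma> \<pi> \<in> {1..k} \<rightarrow>\<^sub>E {1..n}"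
  proof (rule PiE_I)
    fix b assume b: "b \<in> {1..k}"
    then have "inv \<sigma> b \<in> {1..k}" using inv by blast
    then have "\<pi> (inv \<sigma> b) \<in> {1..n}" using \<pi>'(2) by blast
    then have "\<sigma> (\<pi> (inv \<sigma> b)) \<in> {1..n}" using \<sigma>(1) by (simp only: permutes_in_image)
    then show "conjugate k \<sigma> \<pi> b \<in> {1..n}" using b by (simp add: conjugate_def)
  qed (auto simp: conjugate_def)
  ultimately show ?thesis by (simp add: k_perms_def)
qed

text \<open>The positions where the two conjugates differ are the \<sigma>-images of the positions
  where \<pi> and \<rho> differ, so there is again exactly one.\<close>

lemma conjugate_adjacent:
  assumes \<sigma>: "\<sigma> permutes {1..n}" "\<sigma> ` {1..k} = {1..k}"
    and adj: "(\<pi>, \<rho>) \<in> parcs (arrangement_graph n k)"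
  shows "(conjugate k \<sigma> \<pi>, conjugate k \<sigma> \<rho>) \<in> parcs (arrangement_graph n k)"
proof -
  have bij: "bij \<sigma>" using \<sigma>(1) by (rule permutes_bij)
  have \<pi>\<rho>: "\<pi> \<in> k_perms n k" "\<rho> \<in> k_perms n k" using adj by (auto simp: arrangement_graph_def)
  have "\<exists>!i. i \<in> {1..k} \<and> \<pi> i \<noteq> \<rho> i" using adj by (simp add: arrangement_graph_def)
  then obtain i where i: "i \<in> {1..k}" "\<pi> i \<noteq> \<rho> i"
    and uniq: "\<And>j. j \<in> {1..k} \<Longrightarrow> \<pi> j \<noteq> \<rho> j \<Longrightarrow> j = i" by blast
  have conj_at: "conjugate k \<sigma> \<phi> (\<sigma> a) = \<sigma> (\<phi> a)" if "a \<in> {1..k}" for \<phi> a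
    using conjugates_conjugate[OF bij \<sigma>(2), of \<phi>] that by (simp add: conjugates_def)
  have "\<exists>!j. j \<in> {1..k} \<and> conjugate k \<sigma> \<pi> j \<noteq> conjugate k \<sigma> \<rho> j"
  proof (rule ex1I)
    show "\<sigma> i \<in> {1..k} \<and> conjugate k \<sigma> \<pi> (\<sigma> i) \<noteq> conjugate k \<sigma> \<rho> (\<sigma> i)"
      using i \<sigma>(2) bij conj_at by (metis bij_is_inj image_eqI inj_eq)
    fix j assume j: "j \<in> {1..k} \<and> conjugate k \<sigma> \<pi> j \<noteq> conjugate k \<sigma> \<rho> j"
    then obtain a where "a \<in> {1..k}" "j = \<sigma> a" using \<sigma>(2) by blast
    then show "j = \<sigma> i" using uniq[of a] j conj_at by metis
  qed
  then show ?thesis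
    using conjugate_in_k_perms[OF \<sigma>] \<pi>\<rho> by (simp add: arrangement_graph_def)
qed

text \<open>On extensional maps, conjugation by \<open>inv \<sigma>\<close> undoes conjugation by
  \<sigma>.\<close>

lemma inj_on_conjugate:
  assumes \<sigma>: "bij \<sigma>" "\<sigma> ` {1..k} = {1..k}"
  shows "inj_on (conjugate k \<sigma>) (extensional {1..k})"
proof (rule inj_onI)
  fix \<pi> \<rho> assume ext: "\<pi> \<in> extensional {1..k}" "\<rho> \<in> extensional {1..k}"
    and eq: "conjugate k \<sigma> \<pi> = conjugate k \<sigma> \<rho>"
  have "conjugate k (inv \<sigma>) (conjugate k \<sigma> \<phi>) = \<phi>" if "\<phi> \<in> extensional {1..k}" for \<phi>
    using conjugates_inv[OF conjugates_conjugate[OF \<sigma>]] that by (rule conjugate_eqI)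
  then show "\<pi> = \<rho>" using ext eq by metis
qed

section \<open>Counting neighbours in a class\<close>

text \<open>Conjugation by a \<sigma> that takes \<pi> to \<rho> maps neighbours of \<pi>
  injectively to neighbours of \<rho>. It keeps cycle types, so it does not lead out of
  \<open>B\<close>, which is closed under equality of cycle types.\<close>

lemma card_neighbours_le:
  assumes \<pi>: "\<pi> \<in> k_perms n k" and \<rho>: "\<rho> \<in> k_perms n k" and "k \<le> n"
    and type: "cycle_type k \<pi> = cycle_type k \<rho>"
    and B: "B \<subseteq> k_perms n k"
    and B_closed: "\<And>\<phi> \<psi>. \<phi> \<in> B \<Longrightarrow> \<psi> \<in> k_perms n k \<Longrightarrow> cycle_type k \<phi> = cycle_type k \<psi> \<Longrightarrow> \<psi> \<in> B"
  shows "card {\<phi> \<in> B. (\<pi>, \<phi>) \<in> parcs (arrangement_graph n k)}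
    \<le> card {\<phi> \<in> B. (\<rho>, \<phi>) \<in> parcs (arrangement_graph n k)}"
proof -
  obtain \<sigma> where \<sigma>: "\<sigma> permutes {1..n}" and conj: "conjugates k \<sigma> \<pi> \<rho>"
    using conjugate_if_same_cycle_type[OF \<pi> \<rho> \<open>k \<le> n\<close> type] .
  have bij: "bij \<sigma>" and \<sigma>_k: "\<sigma> ` {1..k} = {1..k}" using conj by (auto simp: conjugates_def)
  have \<rho>_eq: "conjugate k \<sigma> \<pi> = \<rho>"
    using conj by (rule conjugate_eqI) (use \<rho> in \<open>auto simp: k_perms_def PiE_def\<close>)
  show ?thesis
  proof (rule card_inj_on_le)
    have "B \<subseteq> extensional {1..k}" using B by (auto simp: k_perms_def PiE_def)
    then show "inj_on (conjugate k \<sigma>) {\<phi> \<in> B. (\<pi>, \<phi>) \<in> parcs (arrangement_graph n k)}"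
      using inj_on_conjugate[OF bij \<sigma>_k] by (auto intro: inj_on_subset)
    have "conjugate k \<sigma> \<phi> \<in> B" if "\<phi> \<in> B" for \<phi>
    proof (rule B_closed[OF that])
      have \<phi>: "\<phi> \<in> k_perms n k" using that B by blast
      then show \<psi>: "conjugate k \<sigma> \<phi> \<in> k_perms n k" by (rule conjugate_in_k_perms[OF \<sigma> \<sigma>_k])
      show "cycle_type k \<phi> = cycle_type k (conjugate k \<sigma> \<phi>)"
        using conjugates_conjugate[OF bij \<sigma>_k]
        by (rule cycle_type_conjugates) (use \<phi> \<psi> in \<open>auto simp: k_perms_def\<close>)
    qed
    then show "conjugate k \<sigma> ` {\<phi> \<in> B. (\<pi>, \<phi>) \<in> parcs (arrangement_graph n k)}
        \<subseteq> {\<phi> \<in> B. (\<rho>, \<phi>) \<in> parcs (arrangement_graph n k)}"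
      using conjugate_adjacent[OF \<sigma> \<sigma>_k, of \<pi>] \<rho>_eq by auto
    show "finite {\<phi> \<in> B. (\<rho>, \<phi>) \<in> parcs (arrangement_graph n k)}"
      using B finite_k_perms by (auto intro: finite_subset)
  qed
qed

theorem theorem6:
  fixes n k :: nat
  assumes "1 \<le> k" and "k \<le> n"
  shows "equitable_partition (arrangement_graph n k) (cycle_type_partition n k)"
proof -
  define R where "R = {(\<pi>, \<rho>). \<pi> \<in> k_perms n k \<and> \<rho> \<in> k_perms n k \<and>
                            cycle_type k \<pi> = cycle_type k \<rho>}"
  have P: "cycle_type_partition n k = k_perms n k // R"
    unfolding cycle_type_partition_def R_def ..
  have "equiv (k_perms n k) R"
    by (rule equivI) (auto simp: R_def refl_on_def sym_def trans_def)
  then have "partition_on (pverts (arrangement_graph n k)) (cycle_type_partition n k)"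
    by (simp add: P arrangement_graph_def partition_on_quotient)
  moreover have "\<exists>d. \<forall>\<pi>\<in>A. card {\<phi> \<in> B. (\<pi>, \<phi>) \<in> parcs (arrangement_graph n k)} = d"
    if A: "A \<in> cycle_type_partition n k" and B: "B \<in> cycle_type_partition n k" for A B
  proof -
    have B_sub: "B \<subseteq> k_perms n k"
      and B_closed: "\<And>\<phi> \<psi>. \<phi> \<in> B \<Longrightarrow> \<psi> \<in> k_perms n k \<Longrightarrow> cycle_type k \<phi> = cycle_type k \<psi> \<Longrightarrow> \<psi> \<in> B"
      using B by (auto simp: P quotient_def R_def)
    have A': "\<pi> \<in> k_perms n k" "\<rho> \<in> k_perms n k" "cycle_type k \<pi> = cycle_type k \<rho>"
      if "\<pi> \<in> A" "\<rho> \<in> A" for \<pi> \<rho>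
      using A that by (auto simp: P quotient_def R_def)
    have "card {\<phi> \<in> B. (\<pi>, \<phi>) \<in> parcs (arrangement_graph n k)}
        \<le> card {\<phi> \<in> B. (\<rho>, \<phi>) \<in> parcs (arrangement_graph n k)}"
      if "\<pi> \<in> A" "\<rho> \<in> A" for \<pi> \<rho>
      using card_neighbours_le[OF A'(1,2)[OF that] \<open>k \<le> n\<close> A'(3)[OF that] B_sub B_closed] .
    \<comment> \<open>The inequality holds for both orders of any pair in \<open>A\<close>, so the
      number of neighbours in \<open>B\<close> is constant on \<open>A\<close>.\<close>
    then show ?thesis by (meson order_antisym)
  qed
  ultimately show ?thesis by (simp add: equitable_partition_def)
qed

end
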